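(* Given a one-parameter similarity family $F_t$ on $\mathbb{R}^d$, there exists a real number $\tau\in[0,t_0)$ such that the attractor $A_t$ of $F_t$ is connected for all $t\in(\tau,t_0)$.
   Context: A function $f:\mathbb{R}^d\to\mathbb{R}^d$ is affine if $f(x)=Lx+a$, where $L$ is a non-singular $d\times d$ real matrix (the linear part of $f$) and $a\in\mathbb{R}^d$. A one-parameter affine family is given by $N\ge 2$ affine functions $F=\{f_1,\dots,f_N\}$ on $\mathbb{R}^d$ and vectors $q_1,\dots,q_N\in\mathbb{R}^d$; for each real $t\ge 0$ it is $F_t=\{t f_i(x)+q_i : 1\le i\le N\}$. It is a similarity family if each function is a similarity transformation. The Hutchinson operator of $F_t$ on non-empty compact sets is $F_t(K)=\bigcup_{f\in F_t} f(K)$. A non-empty compact set $A_t$ is the attractor of $F_t$ if $A_t=\lim_{k\to\infty}F_t^k(K)$ in the Hausdorff metric for every non-empty compact $K$. If $L_1,\dots,L_N$ are the linear parts of $f_1,\dots,f_N$, the joint spectral radius of $F$ is $\rho(F)=\limsup_{k\to\infty}\big(\max\|L_{i_1}\cdots L_{i_k}\|\big)^{1/k}$, the maximum being over all words of length $k$ in $\{1,\dots,N\}$. Set $t_0=1/\rho(F)$; the attractor $A_t$ exists exactly for $t\in[0,t_0)$. *)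

theory Defs
  imports "HOL-Analysis.Analysis"
begin

section \<open>Affine functions and similarities\<close>

definition affine_function :: "(real ^ 'n \<Rightarrow> real ^ 'n) \<Rightarrow> bool" where
  "affine_function f \<longleftrightarrow>
     (\<exists>(L :: real ^ 'n ^ 'n) a. invertible L \<and> (\<forall>x. f x = L *v x + a))"

definition linear_part :: "(real ^ 'n \<Rightarrow> real ^ 'n) \<Rightarrow> real ^ 'n ^ 'n" where
  "linear_part f = (THE L. \<exists>a. \<forall>x. f x = L *v x + a)"

lemma linear_part_eq:
  fixes L :: "real ^ 'n ^ 'n"
  assumes "\<And>x. f x = L *v x + a"
  shows "linear_part f = L"
  unfolding linear_part_def
proof (rule the_equality)
  show "\<exists>a. \<forall>x. f x = L *v x + a" using assms by blast
next
  fix M :: "real ^ 'n ^ 'n"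
  assume "\<exists>b. \<forall>x. f x = M *v x + b"
  then obtain b where b: "\<And>x. f x = M *v x + b" by blast
  have "b = a" using assms[of 0] b[of 0] by simp
  then have "M *v x = L *v x" for x using assms[of x] b[of x] by simp
  then show "M = L" by (simp add: matrix_eq)
qed

definition similarity :: "('a::metric_space \<Rightarrow> 'a) \<Rightarrow> bool" where
  "similarity f \<longleftrightarrow> (\<exists>r>0. \<forall>x y. dist (f x) (f y) = r * dist x y)"

section \<open>One-parameter families\<close>

definition affine_family :: "nat \<Rightarrow> (nat \<Rightarrow> real ^ 'n \<Rightarrow> real ^ 'n) \<Rightarrow> bool" where
  "affine_family N f \<longleftrightarrow> N \<ge> 2 \<and> (\<forall>i\<in>{1..N}. affine_function (f i))"

definition similarity_family :: "nat \<Rightarrow> (nat \<Rightarrow> real ^ 'n \<Rightarrow> real ^ 'n) \<Rightarrow> bool" where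
  "similarity_family N f \<longleftrightarrow> affine_family N f \<and> (\<forall>i\<in>{1..N}. similarity (f i))"

definition family_at ::
  "nat \<Rightarrow> (nat \<Rightarrow> real ^ 'n \<Rightarrow> real ^ 'n) \<Rightarrow> (nat \<Rightarrow> real ^ 'n) \<Rightarrow> real \<Rightarrow> (real ^ 'n \<Rightarrow> real ^ 'n) set"
  where "family_at N f q t = (\<lambda>i x. t *\<^sub>R f i x + q i) ` {1..N}"

section \<open>Attractors\<close>

definition hutchinson :: "('a \<Rightarrow> 'a) set \<Rightarrow> 'a set \<Rightarrow> 'a set" where
  "hutchinson F K = (\<Union>g\<in>F. g ` K)"

text \<open>Only meaningful for non-empty bounded sets, where both suprema are finite.\<close>

definition hausdorff_dist :: "'a::metric_space set \<Rightarrow> 'a set \<Rightarrow> real" where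
  "hausdorff_dist A B = max (SUP x\<in>A. infdist x B) (SUP y\<in>B. infdist y A)"

definition is_attractor :: "('a::metric_space \<Rightarrow> 'a) set \<Rightarrow> 'a set \<Rightarrow> bool" where
  "is_attractor F A \<longleftrightarrow> A \<noteq> {} \<and> compact A \<and>
     (\<forall>K. K \<noteq> {} \<and> compact K \<longrightarrow>
        (\<lambda>k. hausdorff_dist ((hutchinson F ^^ k) K) A) \<longlonglongrightarrow> 0)"

section \<open>Joint spectral radius\<close>

definition words :: "nat \<Rightarrow> nat \<Rightarrow> nat list set" where
  "words N k = {w. length w = k \<and> set w \<subseteq> {1..N}}"

definition word_matrix :: "(nat \<Rightarrow> real ^ 'n ^ 'n) \<Rightarrow> nat list \<Rightarrow> real ^ 'n ^ 'n" where
  "word_matrix L w = foldr (\<lambda>i M. L i ** M) w (mat 1)"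

text \<open>The upper limit is formed in \<^typ>\<open>ereal\<close>.  If every \<open>L\<^sub>i\<close> has operator norm at
  most \<open>C\<close>, all terms with \<open>k > 0\<close> lie between 0 and \<open>C\<close>, so it is finite and the conversion
  back to \<^typ>\<open>real\<close> loses nothing.\<close>

definition joint_spectral_radius ::
  "nat \<Rightarrow> (nat \<Rightarrow> real ^ 'n \<Rightarrow> real ^ 'n) \<Rightarrow> real" where
  "joint_spectral_radius N f = real_of_ereal (limsup (\<lambda>k. ereal (root k
     (MAX w\<in>words N k. onorm ((*v) (word_matrix (\<lambda>i. linear_part (f i)) w))))))"

definition threshold :: "nat \<Rightarrow> (nat \<Rightarrow> real ^ 'n \<Rightarrow> real ^ 'n) \<Rightarrow> real" where
  "threshold N f = 1 / joint_spectral_radius N f"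

section \<open>Uniqueness of the attractor\<close>

lemma bdd_above_infdist:
  fixes A B :: "'a::metric_space set"
  assumes "compact A" "B \<noteq> {}"
  shows "bdd_above ((\<lambda>x. infdist x B) ` A)"
proof -
  have "compact ((\<lambda>x. infdist x B) ` A)"
    by (intro compact_continuous_image continuous_intros assms)
  then show ?thesis by (simp add: bounded_imp_bdd_above compact_imp_bounded)
qed

lemma compact_hutchinson_funpow:
  fixes F :: "('a::metric_space \<Rightarrow> 'a) set"
  assumes "finite F" "F \<noteq> {}" "\<And>g. g \<in> F \<Longrightarrow> continuous_on UNIV g" "K \<noteq> {}" "compact K"
  shows "(hutchinson F ^^ k) K \<noteq> {} \<and> compact ((hutchinson F ^^ k) K)"
proof (induction k)
  case (Suc k)
  then show ?case using assms
    by (auto simp: hutchinson_def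
        intro!: compact_UN compact_continuous_image intro: continuous_on_subset)
qed (use assms in auto)

lemma is_attractor_unique:
  fixes F :: "('a::heine_borel \<Rightarrow> 'a) set"
  assumes F: "finite F" "F \<noteq> {}" "\<And>g. g \<in> F \<Longrightarrow> continuous_on UNIV g"
    and A: "is_attractor F A" and B: "is_attractor F B"
  shows "A = B"
proof -
  have sub: "A \<subseteq> B" if A: "is_attractor F A" and B: "is_attractor F B" for A B
  proof
    fix x assume x: "x \<in> A"
    have cA: "A \<noteq> {}" "compact A" and cB: "B \<noteq> {}" "compact B"
      using A B by (auto simp: is_attractor_def)
    define S where "S k = (hutchinson F ^^ k) A" for k
    have S: "S k \<noteq> {}" "compact (S k)" for k
      using compact_hutchinson_funpow[OF F cA] by (auto simp: S_def)
    have lim: "(\<lambda>k. hausdorff_dist (S k) A + hausdorff_dist (S k) B) \<longlonglongrightarrow> 0 + 0"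
      using A B cA by (intro tendsto_add) (auto simp: is_attractor_def S_def)
    have "infdist x B \<le> hausdorff_dist (S k) A + hausdorff_dist (S k) B" for k
    proof -
      obtain y where y: "y \<in> S k" "infdist x (S k) = dist x y"
        using infdist_attains_inf[of "S k" x] S[of k] compact_imp_closed by blast
      have "infdist x (S k) \<le> hausdorff_dist (S k) A"
        unfolding hausdorff_dist_def
        by (intro max.coboundedI2 cSUP_upper x bdd_above_infdist cA S)
      moreover have "infdist y B \<le> hausdorff_dist (S k) B"
        unfolding hausdorff_dist_def
        by (intro max.coboundedI1 cSUP_upper y bdd_above_infdist cB S)
      moreover have "infdist x B \<le> infdist y B + dist x y"
        by (rule infdist_triangle)
      ultimately show ?thesis using y by simp
    qed
    then have "infdist x B \<le> 0"
      using LIMSEQ_le_const[OF lim] by simp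
    then have "infdist x B = 0" using infdist_nonneg[of x B] by linarith
    then show "x \<in> B"
      using in_closed_iff_infdist_zero cB compact_imp_closed by blast
  qed
  show ?thesis using sub A B by blast
qed

end

theory Submission
  imports Defs
begin

text \<open>
  If \<open>f\<^sub>i\<close> scales distances by \<open>r\<^sub>i\<close>, then a product of \<open>k\<close> linear parts scales norms by the product
  of the corresponding ratios, so the joint spectral radius is \<open>max r\<^sub>i\<close>
  (\<open>joint_spectral_radius_similarities\<close>). Below the threshold every map \<open>g\<^sub>i = t f\<^sub>i + q\<^sub>i\<close> of
  the family is a contraction, and the attractor \<open>A\<close> exists as the compact set invariant under the Hutchinson
  operator. At the threshold the largest ratio reaches 1 while the smallest stays positive, and this
  leaves no room for a gap in \<open>A\<close>.

  Suppose \<open>A\<close> is disconnected. Then it can be cut into two non-empty closed parts in such a way that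
  no image \<open>g\<^sub>i(A)\<close> is cut (\<open>connected_if_pieces_not_separated\<close>): if a cut does divide some
  \<open>g\<^sub>i(A)\<close>, pulling it back by \<open>g\<^sub>i\<close> gives a cut of \<open>A\<close> with a wider gap, and the gap cannot exceed
  the diameter. Let \<open>g\<close> be the map with the largest ratio \<open>a\<close>, and \<open>h\<close>, with ratio \<open>b\<close>, some map whose
  image of \<open>A\<close> lies on the other side of the cut. The compositions of \<open>g\<close> and \<open>h\<close> then carry a small
  ball around a point of \<open>A\<close> to disjoint balls. Those from compositions of length \<open>k\<close> have total volume
  proportional to \<open>(a^d + b^d)^k\<close>, where \<open>d\<close> is the dimension, and they all lie in a fixed ball. Hence
  \<open>a^d + b^d \<le> 1\<close> (\<open>separated_pieces_volume\<close>).

  With \<open>R\<close> the largest and \<open>m\<close> the smallest of the \<open>r\<^sub>i\<close> this says \<open>t^d (R^d + m^d) \<le> 1\<close>, which fails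
  as soon as \<open>t\<close> exceeds \<open>\<tau> = (R^d + m^d)^(-1/d)\<close>; and \<open>\<tau> < 1/R\<close> because \<open>m > 0\<close>.
\<close>

section \<open>Existence of the attractor of a contractive family\<close>

lemma hutchinson_mono: "K \<subseteq> K' \<Longrightarrow> hutchinson F K \<subseteq> hutchinson F K'"
  unfolding hutchinson_def by blast

lemma contraction_continuous:
  fixes g :: "'a::metric_space \<Rightarrow> 'a"
  assumes "\<And>x y. dist (g x) (g y) \<le> s * dist x y"
  shows "continuous_on S g"
proof -
  have "dist (g x) (g y) \<le> max s 0 * dist x y" for x y
    using assms[of x y] mult_right_mono[of s "max s 0" "dist x y"] by simp
  then have "(max s 0)-lipschitz_on S g"
    by (intro lipschitz_onI) auto
  then show ?thesis
    by (rule lipschitz_on_continuous_on)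
qed

lemma funpow_hutchinson_antimono:
  assumes "hutchinson F B \<subseteq> B" "m \<le> n"
  shows "(hutchinson F ^^ n) B \<subseteq> (hutchinson F ^^ m) B"
  using assms(2)
proof (induction rule: dec_induct)
  case (step k)
  have "(hutchinson F ^^ Suc k) B \<subseteq> (hutchinson F ^^ k) B" for k
    by (induction k) (use assms(1) in \<open>auto dest: hutchinson_mono\<close>)
  then show ?case using step.IH by blast
qed simp

text \<open>A large ball is mapped into itself, and the intersection of its iterates is the invariant set.
  That this intersection is contained in its own image is where compactness and the finiteness of
  the family enter: a point outside the image of the intersection is already outside the image of
  some iterate.\<close>

lemma invariant_compact_exists:
  fixes F :: "('a::heine_borel \<Rightarrow> 'a) set"
  assumes fin: "finite F" "F \<noteq> {}" and s: "0 \<le> s" "s < 1"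
    and contr: "\<And>g x y. g \<in> F \<Longrightarrow> dist (g x) (g y) \<le> s * dist x y"
  shows "\<exists>A. A \<noteq> {} \<and> compact A \<and> hutchinson F A = A"
proof -
  have cont: "continuous_on S g" if "g \<in> F" for g S
    using contr[OF that] by (rule contraction_continuous)
  define p :: 'a where "p = undefined"
  define c where "c = (MAX g\<in>F. dist (g p) p)"
  have c: "dist (g p) p \<le> c" if "g \<in> F" for g
    using fin that by (simp add: c_def)
  then have c0: "c \<ge> 0"
    using fin by (metis all_not_in_conv dual_order.trans zero_le_dist)
  \<comment> \<open>The radius solves \<open>c + s * r = r\<close>, so the maps send the ball into itself.\<close>
  define B where "B = cball p (c / (1 - s))"
  have B: "B \<noteq> {}" "compact B"
    using divide_nonneg_pos[OF c0, of "1 - s"] s(2) by (auto simp: B_def)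
  have FB: "hutchinson F B \<subseteq> B"
  proof -
    have "dist p (g x) \<le> c / (1 - s)" if g: "g \<in> F" and x: "dist p x \<le> c / (1 - s)" for g x
    proof -
      have "dist p (g x) \<le> dist (g p) p + dist (g p) (g x)"
        by (metis dist_commute dist_triangle)
      also have "\<dots> \<le> c + s * (c / (1 - s))"
        using c[OF g] contr[OF g, of p x] mult_left_mono[OF x s(1)] by linarith
      also have "\<dots> = c / (1 - s)"
        using s(2) by (simp add: field_simps)
      finally show ?thesis .
    qed
    then show ?thesis unfolding hutchinson_def B_def by auto
  qed
  define S where "S k = (hutchinson F ^^ k) B" for k
  have S: "S k \<noteq> {}" "compact (S k)" for k
    using compact_hutchinson_funpow[OF fin cont B(1) B(2)] by (auto simp: S_def)
  have dec: "S n \<subseteq> S m" if "m \<le> n" for m n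
    unfolding S_def using funpow_hutchinson_antimono[OF FB that] .
  have SSuc: "S (Suc k) = hutchinson F (S k)" for k
    by (simp add: S_def)
  define A where "A = (\<Inter>k. S k)"
  have "A \<noteq> {}"
    unfolding A_def using compact_nest[of S] S dec by blast
  moreover have "compact A"
    unfolding A_def using S by (intro compact_Inter) auto
  moreover have "hutchinson F A \<subseteq> A"
  proof -
    have "hutchinson F A \<subseteq> S k" for k
    proof -
      have "hutchinson F A \<subseteq> S (Suc k)"
        unfolding SSuc by (rule hutchinson_mono) (auto simp: A_def)
      then show ?thesis using dec[of k "Suc k"] by auto
    qed
    then show ?thesis unfolding A_def by blast
  qed
  moreover have "A \<subseteq> hutchinson F A"
  proof
    fix x assume x: "x \<in> A"
    show "x \<in> hutchinson F A"
    proof (rule ccontr)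
      assume nx: "x \<notin> hutchinson F A"
      have "\<exists>k. x \<notin> g ` S k" if g: "g \<in> F" for g
      proof (rule ccontr)
        assume "\<nexists>k. x \<notin> g ` S k"
        then have "S k \<inter> g -` {x} \<noteq> {}" for k by blast
        moreover have "compact (S k \<inter> g -` {x})" for k
          using S(2) continuous_on_closed_vimage[of UNIV g] cont[OF g]
          by (intro compact_Int_closed) auto
        ultimately have "(\<Inter>k. S k \<inter> g -` {x}) \<noteq> {}"
          by (intro compact_nest Int_mono dec subset_refl)
        then have "x \<in> g ` A" by (auto simp: A_def)
        then show False using nx g by (auto simp: hutchinson_def)
      qed
      then obtain k where k: "\<And>g. g \<in> F \<Longrightarrow> x \<notin> g ` S (k g)" by metis
      define m where "m = Max (k ` F)"
      have "x \<in> hutchinson F (S m)"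
        using x SSuc[of m] by (auto simp: A_def)
      then obtain g where g: "g \<in> F" "x \<in> g ` S m" by (auto simp: hutchinson_def)
      have "k g \<le> m" using fin g by (simp add: m_def)
      then show False using k[OF g(1)] g(2) dec by blast
    qed
  qed
  ultimately show ?thesis by blast
qed

text \<open>One half of the estimate that the Hutchinson operator contracts the Hausdorff distance. Exchanging
  \<open>K\<close> and \<open>L\<close> gives the other half.\<close>

lemma funpow_hutchinson_approaches:
  fixes F :: "('a::metric_space \<Rightarrow> 'a) set"
  assumes s: "s \<ge> 0"
    and contr: "\<And>g x y. g \<in> F \<Longrightarrow> dist (g x) (g y) \<le> s * dist x y"
    and D: "\<And>x. x \<in> K \<Longrightarrow> \<exists>y\<in>L. dist x y \<le> D"
    and x: "x \<in> (hutchinson F ^^ k) K"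
  shows "\<exists>y\<in>(hutchinson F ^^ k) L. dist x y \<le> s ^ k * D"
  using x
proof (induction k arbitrary: x)
  case (Suc k)
  then obtain g z where g: "g \<in> F" "z \<in> (hutchinson F ^^ k) K" "x = g z"
    by (auto simp: hutchinson_def[of F "(hutchinson F ^^ k) K"])
  obtain y where y: "y \<in> (hutchinson F ^^ k) L" "dist z y \<le> s ^ k * D"
    using Suc.IH[OF g(2)] by blast
  have "dist x (g y) \<le> s * dist z y" using contr g by simp
  also have "\<dots> \<le> s ^ Suc k * D" using mult_left_mono[OF y(2) s] by (simp add: mult.assoc)
  finally show ?case
    using g y by (auto simp: hutchinson_def[of F "(hutchinson F ^^ k) L"])
qed (use D in auto)

lemma invariant_compact_is_attractor:
  fixes F :: "('a::heine_borel \<Rightarrow> 'a) set"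
  assumes fin: "finite F" "F \<noteq> {}" and s: "0 \<le> s" "s < 1"
    and contr: "\<And>g x y. g \<in> F \<Longrightarrow> dist (g x) (g y) \<le> s * dist x y"
    and A: "A \<noteq> {}" "compact A" "hutchinson F A = A"
  shows "is_attractor F A"
  unfolding is_attractor_def
proof (intro conjI allI impI A(1,2))
  fix K :: "'a set" assume K: "K \<noteq> {} \<and> compact K"
  have cont: "continuous_on UNIV g" if "g \<in> F" for g
    using contr[OF that] by (rule contraction_continuous)
  define D where "D = diameter (K \<union> A)"
  have bdd: "bounded (K \<union> A)" using K A by (simp add: compact_imp_bounded)
  have D: "dist x y \<le> D" if "x \<in> K \<union> A" "y \<in> K \<union> A" for x y
    unfolding D_def using diameter_bounded_bound[OF bdd that] .
  have fixA: "(hutchinson F ^^ k) A = A" for k by (induction k) (use A in auto)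
  define S where "S k = (hutchinson F ^^ k) K" for k
  have S: "S k \<noteq> {}" "compact (S k)" for k
    using compact_hutchinson_funpow[OF fin cont] K by (auto simp: S_def)
  have 1: "infdist x A \<le> s ^ k * D" if "x \<in> S k" for x k
  proof -
    have "\<exists>y\<in>A. dist x y \<le> D" if "x \<in> K" for x using D[of x] that A(1) by blast
    then have "\<exists>y\<in>(hutchinson F ^^ k) A. dist x y \<le> s ^ k * D"
      using \<open>x \<in> S k\<close> unfolding S_def
      by (intro funpow_hutchinson_approaches[OF s(1) contr, where K = K])
    then show ?thesis unfolding fixA by (auto intro: infdist_le2)
  qed
  have 2: "infdist x (S k) \<le> s ^ k * D" if "x \<in> A" for x k
  proof -
    have "\<exists>y\<in>K. dist x y \<le> D" if "x \<in> A" for x using D[of x] that K by blast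
    then have "\<exists>y\<in>(hutchinson F ^^ k) K. dist x y \<le> s ^ k * D"
      using \<open>x \<in> A\<close>
      by (intro funpow_hutchinson_approaches[OF s(1) contr, where K = A]) (simp_all add: fixA)
    then show ?thesis unfolding S_def by (auto intro: infdist_le2)
  qed
  have up: "hausdorff_dist (S k) A \<le> s ^ k * D" for k
    unfolding hausdorff_dist_def using 1 2 S A by (intro max.boundedI cSUP_least) auto
  have lo: "0 \<le> hausdorff_dist (S k) A" for k
  proof -
    obtain x where "x \<in> S k" using S by blast
    then have "infdist x A \<le> hausdorff_dist (S k) A"
      unfolding hausdorff_dist_def
      by (intro max.coboundedI1 cSUP_upper bdd_above_infdist A S)
    then show ?thesis using infdist_nonneg order_trans by blast
  qed
  have "(\<lambda>k. s ^ k * D) \<longlonglongrightarrow> 0 * D"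
    using s by (intro tendsto_intros LIMSEQ_power_zero) auto
  then have "(\<lambda>k. s ^ k * D) \<longlonglongrightarrow> 0" by simp
  then show "(\<lambda>k. hausdorff_dist ((hutchinson F ^^ k) K) A) \<longlonglongrightarrow> 0"
    unfolding S_def[symmetric]
    by (rule tendsto_sandwich[OF _ _ tendsto_const, rotated 2]) (use up lo in auto)
qed

section \<open>A disconnected attractor splits along first-level pieces\<close>

text \<open>Induction on the scale of the gap. A cut of \<open>A\<close> with gap \<open>e\<close> pulls back along each map to a cut with
  gap \<open>e / s\<close>, which is trivial by induction; so the cut respects all the pieces \<open>g ` A\<close>, and \<open>piece\<close>
  applies. The induction starts at gaps larger than the diameter.\<close>

lemma separated_splitting_trivial:
  fixes F :: "('a::metric_space \<Rightarrow> 'a) set"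
  assumes s: "0 < s"
    and contr: "\<And>g x y. g \<in> F \<Longrightarrow> dist (g x) (g y) \<le> s * dist x y"
    and A: "hutchinson F A = A" and D: "\<And>x y. x \<in> A \<Longrightarrow> y \<in> A \<Longrightarrow> dist x y \<le> D"
    and piece: "\<And>U V. closed U \<Longrightarrow> closed V \<Longrightarrow> U \<inter> V = {} \<Longrightarrow> U \<union> V = A \<Longrightarrow>
        (\<And>g. g \<in> F \<Longrightarrow> g ` A \<subseteq> U \<or> g ` A \<subseteq> V) \<Longrightarrow> U = {} \<or> V = {}"
    and UV: "closed U" "closed V" "U \<union> V = A"
    and sep: "\<And>u v. u \<in> U \<Longrightarrow> v \<in> V \<Longrightarrow> e \<le> dist u v"
    and e: "s ^ n * D < e" "0 < e"
  shows "U = {} \<or> V = {}"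
  using UV sep e
proof (induction n arbitrary: U V e)
  case 0
  show ?case
  proof (rule ccontr)
    assume "\<not> ?thesis"
    then obtain u v where "u \<in> U" "v \<in> V" by blast
    then show False using 0 D[of u v] by fastforce
  qed
next
  case (Suc n)
  have "closed A" using Suc.prems by blast
  have dj: "U \<inter> V = {}" using Suc.prems(4,6) by fastforce
  show ?case
  proof (rule piece[OF Suc.prems(1,2) dj Suc.prems(3)])
    fix g assume g: "g \<in> F"
    have cont: "continuous_on UNIV g" using contr[OF g] by (rule contraction_continuous)
    have gA: "g ` A \<subseteq> U \<union> V" using A g Suc.prems(3) by (auto simp: hutchinson_def)
    have cl: "closed (A \<inter> g -` W)" if "closed W" for W
      using \<open>closed A\<close> continuous_on_closed_vimage[of UNIV g] cont that by (intro closed_Int) auto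
    have "A \<inter> g -` U = {} \<or> A \<inter> g -` V = {}"
    proof (rule Suc.IH[of _ _ "e / s"])
      show "closed (A \<inter> g -` U)" "closed (A \<inter> g -` V)"
        using cl Suc.prems(1,2) by auto
      show "A \<inter> g -` U \<union> A \<inter> g -` V = A" using gA by blast
      show "e / s \<le> dist u v" if "u \<in> A \<inter> g -` U" "v \<in> A \<inter> g -` V" for u v
        using Suc.prems(4)[of "g u" "g v"] contr[OF g, of u v] that s
        by (auto simp: pos_divide_le_eq mult.commute)
      show "s ^ n * D < e / s" using Suc.prems(5) s by (simp add: pos_less_divide_eq mult.commute mult.left_commute)
      show "0 < e / s" using Suc.prems s by simp
    qed
    then show "g ` A \<subseteq> U \<or> g ` A \<subseteq> V" using gA by blast
  qed
qed

lemma connected_if_pieces_not_separated: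
  fixes F :: "('a::heine_borel \<Rightarrow> 'a) set"
  assumes s: "0 < s" "s < 1"
    and contr: "\<And>g x y. g \<in> F \<Longrightarrow> dist (g x) (g y) \<le> s * dist x y"
    and A: "compact A" "hutchinson F A = A"
    and piece: "\<And>U V. closed U \<Longrightarrow> closed V \<Longrightarrow> U \<inter> V = {} \<Longrightarrow> U \<union> V = A \<Longrightarrow>
        (\<And>g. g \<in> F \<Longrightarrow> g ` A \<subseteq> U \<or> g ` A \<subseteq> V) \<Longrightarrow> U = {} \<or> V = {}"
  shows "connected A"
proof -
  have "U = {} \<or> V = {}" if UV: "closed U" "closed V" "U \<union> V = A" "U \<inter> V = {}" for U V
  proof -
    have "compact U" using UV A(1) by (metis Un_upper1 compact_Int_closed inf.absorb2)
    then obtain e where e: "e > 0" "\<And>u v. u \<in> U \<Longrightarrow> v \<in> V \<Longrightarrow> e \<le> dist u v"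
      using separate_compact_closed[of U V] UV by metis
    have D: "dist x y \<le> diameter A" if "x \<in> A" "y \<in> A" for x y
      using diameter_bounded_bound[OF compact_imp_bounded[OF A(1)] that] .
    have "(\<lambda>n. s ^ n * diameter A) \<longlonglongrightarrow> 0 * diameter A"
      using s by (intro tendsto_intros LIMSEQ_power_zero) auto
    then have "\<forall>\<^sub>F n in sequentially. s ^ n * diameter A < e"
      using e(1) by (intro order_tendstoD(2)) auto
    then obtain n where n: "s ^ n * diameter A < e"
      by (auto simp: eventually_sequentially)
    show ?thesis
      using separated_splitting_trivial[OF s(1) contr A(2) D piece UV(1-3) e(2) n e(1)] .
  qed
  then show ?thesis using connected_closed_set[OF compact_imp_closed[OF A(1)]] by blast
qed

section \<open>Packing separated pieces\<close>

text \<open>A pair \<open>(x, r)\<close> stands for the open ball with centre \<open>x\<close> and radius \<open>r\<close>. Asking for the sum of the radii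
  to be at most the distance of the centres, instead of disjointness of the balls as sets, makes the
  condition pass to images under any map with a lower Lipschitz bound, surjective or not.\<close>

definition ball_packing :: "('a::metric_space \<times> real) set \<Rightarrow> bool" where
  "ball_packing P \<longleftrightarrow> finite P \<and> (\<forall>z\<in>P. 0 < snd z) \<and>
     pairwise (\<lambda>z w. snd z + snd w \<le> dist (fst z) (fst w)) P"

lemma ball_packing_volume_le:
  fixes P :: "('a::euclidean_space \<times> real) set"
  assumes P: "ball_packing P" and R: "0 < R" "\<And>z. z \<in> P \<Longrightarrow> ball (fst z) (snd z) \<subseteq> ball p R"
  shows "(\<Sum>z\<in>P. snd z ^ DIM('a)) \<le> R ^ DIM('a)"
proof -
  define v where "v = measure lebesgue (ball (0::'a) 1)"
  have v: "v > 0" unfolding v_def using content_ball_pos[of 1 "0::'a"] by simp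
  have vol: "measure lebesgue (ball x r) = r ^ DIM('a) * v" if "r > 0" for x :: 'a and r
    using content_ball_conv_unit_ball[of r x] that by (simp add: v_def)
  have fin: "finite P" and pos: "\<And>z. z \<in> P \<Longrightarrow> snd z > 0"
    and sep: "\<And>z w. z \<in> P \<Longrightarrow> w \<in> P \<Longrightarrow> z \<noteq> w \<Longrightarrow> snd z + snd w \<le> dist (fst z) (fst w)"
    using P by (auto simp: ball_packing_def pairwise_def)
  have "disjoint_family_on (\<lambda>z. ball (fst z) (snd z)) P"
    unfolding disjoint_family_on_def
  proof (intro ballI impI)
    fix z w assume zw: "z \<in> P" "w \<in> P" "z \<noteq> w"
    have "\<not> (dist (fst z) x < snd z \<and> dist (fst w) x < snd w)" for x
      using sep[OF zw] dist_triangle2[of "fst z" "fst w" x] by linarith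
    then show "ball (fst z) (snd z) \<inter> ball (fst w) (snd w) = {}" by auto
  qed
  then have "(\<Sum>z\<in>P. measure lebesgue (ball (fst z) (snd z)))
      = measure lebesgue (\<Union>z\<in>P. ball (fst z) (snd z))"
    using fin by (intro measure_UNION'[symmetric]) (auto simp: pairwise_def disjoint_family_on_def disjnt_def)
  also have "\<dots> \<le> measure lebesgue (ball p R)"
    using R(2) fin by (intro measure_mono_fmeasurable) (auto intro!: sets.finite_UN)
  also have "\<dots> = R ^ DIM('a) * v" using vol R(1) by simp
  also have "(\<Sum>z\<in>P. measure lebesgue (ball (fst z) (snd z))) = (\<Sum>z\<in>P. snd z ^ DIM('a)) * v"
    using vol pos by (simp add: sum_distrib_right)
  finally show ?thesis using v by simp
qed

text \<open>A packing of balls centred in \<open>A\<close> has an image packing under \<open>g\<close>, with radii scaled by \<open>a\<close>, and one under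
  \<open>h\<close>, with radii scaled by \<open>b\<close>. When the radii are at most half the gap between \<open>U\<close> and \<open>V\<close>, these two
  do not interfere, so together they form a packing whose volume is \<open>a^d + b^d\<close> times the original one.
  Repeating this from a single ball would give unbounded volume inside a fixed ball if that factor
  were greater than 1.\<close>

lemma separated_pieces_volume:
  fixes g h :: "'a::euclidean_space \<Rightarrow> 'a"
  assumes a: "0 < a" "a \<le> 1" and g: "\<And>x y. a * dist x y \<le> dist (g x) (g y)"
    and b: "0 < b" "b \<le> 1" and h: "\<And>x y. b * dist x y \<le> dist (h x) (h y)"
    and A: "compact A" "A \<noteq> {}" and UV: "closed U" "closed V" "U \<inter> V = {}" "U \<union> V = A"
    and gU: "g ` A \<subseteq> U" and hV: "h ` A \<subseteq> V"
  shows "a ^ DIM('a) + b ^ DIM('a) \<le> 1"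
proof (rule ccontr)
  define \<beta> where "\<beta> = a ^ DIM('a) + b ^ DIM('a)"
  assume "\<not> a ^ DIM('a) + b ^ DIM('a) \<le> 1"
  then have \<beta>: "\<beta> > 1" by (simp add: \<beta>_def)
  have "compact U" using UV A(1) by (metis Un_upper1 compact_Int_closed inf.absorb2)
  then obtain e where e: "e > 0" "\<And>u v. u \<in> U \<Longrightarrow> v \<in> V \<Longrightarrow> e \<le> dist u v"
    using separate_compact_closed[of U V] UV by metis
  define d where "d = e / 2"
  have d: "d > 0" "\<And>u v. u \<in> U \<Longrightarrow> v \<in> V \<Longrightarrow> d + d \<le> dist u v"
    using e by (auto simp: d_def)
  have inj_scale: "inj_on (map_prod k ((*) c)) S"
    if "c > 0" "\<And>x y. c * dist x y \<le> dist (k x) (k y)" for k :: "'a \<Rightarrow> 'a" and c S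
  proof (rule inj_onI)
    fix z w assume eq: "map_prod k ((*) c) z = map_prod k ((*) c) w"
    then have "k (fst z) = k (fst w)" "c * snd z = c * snd w" by (auto simp: map_prod_def split: prod.splits)
    moreover have "c * dist (fst z) (fst w) \<le> 0" using that(2)[of "fst z" "fst w"] calculation by simp
    ultimately show "z = w" using that(1) by (auto simp: mult_le_0_iff prod_eq_iff)
  qed
  have pack: "\<exists>P. ball_packing P \<and> (\<forall>z\<in>P. fst z \<in> A \<and> snd z \<le> d) \<and>
      (\<Sum>z\<in>P. snd z ^ DIM('a)) = \<beta> ^ k * d ^ DIM('a)" for k
  proof (induction k)
    case 0
    obtain p where "p \<in> A" using A(2) by blast
    then show ?case using d(1) by (intro exI[of _ "{(p, d)}"]) (auto simp: ball_packing_def)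
  next
    case (Suc k)
    then obtain P where P: "ball_packing P" "\<And>z. z \<in> P \<Longrightarrow> fst z \<in> A \<and> snd z \<le> d"
      and sumP: "(\<Sum>z\<in>P. snd z ^ DIM('a)) = \<beta> ^ k * d ^ DIM('a)" by blast
    have fin: "finite P" and pos: "\<And>z. z \<in> P \<Longrightarrow> snd z > 0"
      and sep: "\<And>z w. z \<in> P \<Longrightarrow> w \<in> P \<Longrightarrow> z \<noteq> w \<Longrightarrow> snd z + snd w \<le> dist (fst z) (fst w)"
      using P(1) by (auto simp: ball_packing_def pairwise_def)
    define G where "G = map_prod g ((*) a)"
    define H where "H = map_prod h ((*) b)"
    have G: "fst (G z) = g (fst z)" "snd (G z) = a * snd z" and H: "fst (H z) = h (fst z)" "snd (H z) = b * snd z" for z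
      by (simp_all add: G_def H_def)
    have GU: "fst (G z) \<in> U" and HV: "fst (H z) \<in> V" if "z \<in> P" for z
      using P(2)[OF that] gU hV G H by auto
    have small: "snd (G z) \<le> d" "snd (H z) \<le> d" if "z \<in> P" for z
      using P(2)[OF that] pos[OF that] a b mult_left_le_one_le[of "snd z" a] mult_left_le_one_le[of "snd z" b]
      unfolding G H by linarith+
    have cross: "snd (G z) + snd (H w) \<le> dist (fst (G z)) (fst (H w))" if "z \<in> P" "w \<in> P" for z w
      using d(2)[OF GU[OF that(1)] HV[OF that(2)]] small that by (smt (verit))
    have inner: "c * snd z + c * snd w \<le> dist (k (fst z)) (k (fst w))"
      if "z \<in> P" "w \<in> P" "z \<noteq> w" "c > 0" "\<And>x y. c * dist x y \<le> dist (k x) (k y)" for c k z w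
    proof -
      have "c * (snd z + snd w) \<le> c * dist (fst z) (fst w)" using sep that by simp
      then show ?thesis using that(5)[of "fst z" "fst w"] by (simp add: distrib_left)
    qed
    have "pairwise (\<lambda>z w. snd z + snd w \<le> dist (fst z) (fst w)) (G ` P \<union> H ` P)"
    proof (rule pairwiseI)
      fix z w assume zw: "z \<in> G ` P \<union> H ` P" "w \<in> G ` P \<union> H ` P" "z \<noteq> w"
      then consider (GG) z' w' where "z = G z'" "w = G w'" "z' \<in> P" "w' \<in> P"
        | (HH) z' w' where "z = H z'" "w = H w'" "z' \<in> P" "w' \<in> P"
        | (GH) z' w' where "z = G z'" "w = H w'" "z' \<in> P" "w' \<in> P"
        | (HG) z' w' where "z = H z'" "w = G w'" "z' \<in> P" "w' \<in> P"
        by blast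
      then show "snd z + snd w \<le> dist (fst z) (fst w)"
      proof cases
        case GG then show ?thesis using inner[OF _ _ _ a(1) g, of z' w'] zw(3) G by auto
      next
        case HH then show ?thesis using inner[OF _ _ _ b(1) h, of z' w'] zw(3) H by auto
      next
        case GH then show ?thesis using cross by simp
      next
        case HG then show ?thesis using cross[of w' z'] by (simp add: dist_commute add.commute)
      qed
    qed
    then have "ball_packing (G ` P \<union> H ` P)"
      using fin pos a b by (auto simp: ball_packing_def G H)
    moreover have "\<forall>z\<in>G ` P \<union> H ` P. fst z \<in> A \<and> snd z \<le> d"
      using GU HV small UV(4) by auto
    moreover have "(\<Sum>z\<in>G ` P \<union> H ` P. snd z ^ DIM('a)) = \<beta> ^ Suc k * d ^ DIM('a)"
    proof -
      have "G ` P \<inter> H ` P = {}"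
      proof (rule ccontr)
        assume "G ` P \<inter> H ` P \<noteq> {}"
        then obtain z w where "z \<in> P" "w \<in> P" "G z = H w" by blast
        then show False using GU[of z] HV[of w] UV(3) by auto
      qed
      then have "(\<Sum>z\<in>G ` P \<union> H ` P. snd z ^ DIM('a))
          = (\<Sum>z\<in>G ` P. snd z ^ DIM('a)) + (\<Sum>z\<in>H ` P. snd z ^ DIM('a))"
        using fin by (intro sum.union_disjoint) auto
      also have "\<dots> = (\<Sum>z\<in>P. (a * snd z) ^ DIM('a)) + (\<Sum>z\<in>P. (b * snd z) ^ DIM('a))"
        using inj_scale[OF a(1) g, of P] inj_scale[OF b(1) h, of P]
        unfolding G_def[symmetric] H_def[symmetric] by (simp add: sum.reindex G H)
      also have "\<dots> = \<beta> * (\<Sum>z\<in>P. snd z ^ DIM('a))"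
        unfolding \<beta>_def power_mult_distrib distrib_right by (simp only: sum_distrib_left)
      finally show ?thesis unfolding sumP by simp
    qed
    ultimately show ?case by blast
  qed
  obtain p r where r: "\<And>x. x \<in> A \<Longrightarrow> dist p x \<le> r"
    using compact_imp_bounded[OF A(1)] by (auto simp: bounded_def)
  define R where "R = max r 0 + d"
  have "\<beta> ^ k * d ^ DIM('a) \<le> R ^ DIM('a)" for k
  proof -
    obtain P where P: "ball_packing P" "\<And>z. z \<in> P \<Longrightarrow> fst z \<in> A \<and> snd z \<le> d"
      and sumP: "(\<Sum>z\<in>P. snd z ^ DIM('a)) = \<beta> ^ k * d ^ DIM('a)" using pack by blast
    have "ball (fst z) (snd z) \<subseteq> ball p R" if "z \<in> P" for z
    proof
      fix y assume "y \<in> ball (fst z) (snd z)"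
      then show "y \<in> ball p R"
        using P(2)[OF that] r[of "fst z"] dist_triangle[of p y "fst z"] max.cobounded1[of r 0]
        unfolding R_def mem_ball by linarith
    qed
    then show ?thesis
      using ball_packing_volume_le[OF P(1), of R p] d(1) sumP by (simp add: R_def)
  qed
  moreover obtain k where "R ^ DIM('a) / d ^ DIM('a) < \<beta> ^ k"
    using real_arch_pow[OF \<beta>] by blast
  ultimately show False using d(1) by (simp add: pos_divide_less_eq not_less[symmetric])
qed

section \<open>The joint spectral radius of a similarity family\<close>

lemma norm_word_matrix:
  fixes L :: "nat \<Rightarrow> real ^ 'n ^ 'n"
  assumes "\<And>i x. i \<in> set w \<Longrightarrow> norm (L i *v x) = r i * norm x"
  shows "norm (word_matrix L w *v x) = prod_list (map r w) * norm x"
  using assms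
proof (induction w)
  case (Cons i w)
  then show ?case
    by (simp add: word_matrix_def mult.assoc flip: matrix_vector_mul_assoc)
qed (simp add: word_matrix_def)

lemma onorm_of_scaling:
  fixes M :: "real ^ 'n ^ 'n"
  assumes "\<And>x. norm (M *v x) = c * norm x"
  shows "onorm ((*v) M) = c"
proof (rule antisym)
  show "onorm ((*v) M) \<le> c" using assms by (intro onorm_le) simp
  have "norm (M *v axis undefined 1) \<le> onorm ((*v) M) * norm (axis undefined (1::real) :: real ^ 'n)"
    by (intro onorm matrix_vector_mul_bounded_linear)
  then show "c \<le> onorm ((*v) M)" by (simp add: assms)
qed

lemma prod_list_le_power:
  fixes r :: "'a \<Rightarrow> real"
  assumes "\<And>i. i \<in> set w \<Longrightarrow> 0 \<le> r i \<and> r i \<le> R"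
  shows "0 \<le> prod_list (map r w) \<and> prod_list (map r w) \<le> R ^ length w"
  using assms
proof (induction w)
  case (Cons i w)
  then have "0 \<le> r i" "r i \<le> R" "0 \<le> prod_list (map r w)" "prod_list (map r w) \<le> R ^ length w"
    by auto
  then show ?case by (auto intro: mult_mono)
qed simp

text \<open>The maximum over words of length \<open>k\<close> is attained by repeating the letter with the largest ratio.\<close>

lemma joint_spectral_radius_similarities:
  fixes f :: "nat \<Rightarrow> real ^ 'n \<Rightarrow> real ^ 'n"
  assumes L: "\<And>i x. i \<in> {1..N} \<Longrightarrow> norm (linear_part (f i) *v x) = r i * norm x"
    and r: "\<And>i. i \<in> {1..N} \<Longrightarrow> 0 \<le> r i \<and> r i \<le> r j" and j: "j \<in> {1..N}"
  shows "joint_spectral_radius N f = r j"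
proof -
  define L where "L i = linear_part (f i)" for i
  have on: "onorm ((*v) (word_matrix L w)) = prod_list (map r w)" if "w \<in> words N k" for w k
  proof (intro onorm_of_scaling norm_word_matrix)
    fix i and x :: "real ^ 'n"
    assume "i \<in> set w"
    then show "norm (L i *v x) = r i * norm x" using that assms(1) by (auto simp: words_def L_def)
  qed
  have "(MAX w\<in>words N k. onorm ((*v) (word_matrix L w))) = r j ^ k" for k
  proof (rule Max_eqI)
    have "finite (words N k)"
      unfolding words_def using finite_lists_length_eq[of "{1..N}" k] by (simp add: conj_commute)
    then show "finite ((\<lambda>w. onorm ((*v) (word_matrix L w))) ` words N k)" by simp
    fix y assume "y \<in> (\<lambda>w. onorm ((*v) (word_matrix L w))) ` words N k"
    then obtain w where w: "w \<in> words N k" "y = prod_list (map r w)" using on by blast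
    have "prod_list (map r w) \<le> r j ^ length w"
      using prod_list_le_power[of w r "r j"] r w(1) by (fastforce simp: words_def)
    then show "y \<le> r j ^ k" using w by (simp add: words_def)
  next
    have w: "replicate k j \<in> words N k" using j by (auto simp: words_def)
    have "onorm ((*v) (word_matrix L (replicate k j))) = r j ^ k" 
      unfolding on[OF w] by (induction k) auto
    then show "r j ^ k \<in> (\<lambda>w. onorm ((*v) (word_matrix L w))) ` words N k"
      using w by (intro rev_image_eqI[OF w]) simp
  qed
  then have "joint_spectral_radius N f = real_of_ereal (limsup (\<lambda>k. ereal (root k (r j ^ k))))"
    unfolding joint_spectral_radius_def L_def by simp
  \<comment> \<open>The term \<open>k = 0\<close> has to be discarded, since \<open>root 0\<close> is constantly 0.\<close>
  also have "limsup (\<lambda>k. ereal (root k (r j ^ k))) = limsup (\<lambda>k. ereal (r j))"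
    using r[OF j] by (intro Limsup_eq eventually_mono[OF eventually_gt_at_top[of 0]])
      (simp add: real_root_power_cancel)
  also have "\<dots> = ereal (r j)" by (simp add: Limsup_const)
  finally show ?thesis by simp
qed

lemma similarity_linear_part:
  fixes f :: "real ^ 'n \<Rightarrow> real ^ 'n"
  assumes "affine_function f" and r: "\<And>x y. dist (f x) (f y) = r * dist x y"
  shows "norm (linear_part f *v x) = r * norm x"
proof -
  obtain L a where La: "\<And>x. f x = L *v x + a"
    using assms(1) by (auto simp: affine_function_def)
  have "linear_part f = L" using La by (rule linear_part_eq)
  then show ?thesis using r[of x 0] La by (simp add: dist_norm)
qed

section \<open>Connectedness near the threshold\<close>

text \<open>If a cut of the attractor respects all the pieces, then the piece of \<open>g j\<close> and any piece on the
  other side violate the volume bound; hence all pieces lie on the side of \<open>g j\<close>.\<close>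

lemma attractor_connected_of_large_ratios:
  fixes g :: "'i \<Rightarrow> real ^ 'n \<Rightarrow> real ^ 'n"
  assumes I: "finite I" "I \<noteq> {}"
    and g: "\<And>i x y. i \<in> I \<Longrightarrow> dist (g i x) (g i y) = c i * dist x y"
    and c: "\<And>i. i \<in> I \<Longrightarrow> 0 < c i" "\<And>i. i \<in> I \<Longrightarrow> c i < 1"
    and j: "j \<in> I" and big: "\<And>i. i \<in> I \<Longrightarrow> 1 < c j ^ CARD('n) + c i ^ CARD('n)"
  shows "\<exists>A. is_attractor (g ` I) A \<and> connected A"
proof -
  define s where "s = Max (c ` I)"
  have s: "0 < s" "s < 1" and cs: "\<And>i. i \<in> I \<Longrightarrow> c i \<le> s"
    using I c j by (auto simp: s_def Max_gr_iff)
  have contr: "dist (k x) (k y) \<le> s * dist x y" if "k \<in> g ` I" for k x y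
    using that g cs by (auto intro!: mult_right_mono)
  have fin: "finite (g ` I)" "g ` I \<noteq> {}" using I by auto
  obtain A where A: "A \<noteq> {}" "compact A" "hutchinson (g ` I) A = A"
    using invariant_compact_exists[OF fin less_imp_le[OF s(1)] s(2) contr] by blast
  have "is_attractor (g ` I) A"
    using invariant_compact_is_attractor[OF fin less_imp_le[OF s(1)] s(2) contr A] .
  moreover have "connected A"
  proof (rule connected_if_pieces_not_separated[OF s contr A(2,3)])
    fix U V :: "(real ^ 'n) set"
    assume UV: "closed U" "closed V" "U \<inter> V = {}" "U \<union> V = A"
      and mono: "\<And>k. k \<in> g ` I \<Longrightarrow> k ` A \<subseteq> U \<or> k ` A \<subseteq> V"
    have *: "Y = {}" if XY: "closed X" "closed Y" "X \<inter> Y = {}" "X \<union> Y = A"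
      and m: "\<And>i. i \<in> I \<Longrightarrow> g i ` A \<subseteq> X \<or> g i ` A \<subseteq> Y" and jX: "g j ` A \<subseteq> X" for X Y
    proof -
      have "g i ` A \<subseteq> X" if i: "i \<in> I" for i
      proof (rule ccontr)
        assume "\<not> g i ` A \<subseteq> X"
        then have "g i ` A \<subseteq> Y" using m[OF i] by blast
        from separated_pieces_volume[OF c(1)[OF j] less_imp_le[OF c(2)[OF j]] _
            c(1)[OF i] less_imp_le[OF c(2)[OF i]] _ A(2,1) XY jX this]
        show False using big[OF i] g[OF i] g[OF j] by simp
      qed
      then have "A \<subseteq> X" using A(3) by (fastforce simp: hutchinson_def)
      then show ?thesis using XY by blast
    qed
    show "U = {} \<or> V = {}"
    proof (cases "g j ` A \<subseteq> U")
      case True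
      then show ?thesis using *[OF UV] mono by blast
    next
      case False
      then have "g j ` A \<subseteq> V" using mono j by blast
      then show ?thesis using *[of V U] UV mono by (metis Int_commute Un_commute imageI)
    qed
  qed
  ultimately show ?thesis by blast
qed

theorem theorem6p2:
  fixes N :: nat
    and f :: "nat \<Rightarrow> real ^ 'n \<Rightarrow> real ^ 'n"
    and q :: "nat \<Rightarrow> real ^ 'n"
  assumes "similarity_family N f"
  shows "\<exists>\<tau>::real. 0 \<le> \<tau> \<and> \<tau> < threshold N f \<and>
           (\<forall>t. \<tau> < t \<and> t < threshold N f \<longrightarrow>
              (\<exists>A. is_attractor (family_at N f q t) A \<and> connected A))"
proof -
  have N: "{1..N} \<noteq> {}" "finite {1..N}" and aff: "\<And>i. i \<in> {1..N} \<Longrightarrow> affine_function (f i)"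
    using assms by (auto simp: similarity_family_def affine_family_def)
  have "\<forall>i\<in>{1..N}. \<exists>r>0. \<forall>x y. dist (f i x) (f i y) = r * dist x y"
    using assms by (simp add: similarity_family_def similarity_def)
  then obtain r where r0: "\<And>i. i \<in> {1..N} \<Longrightarrow> r i > 0"
    and r: "\<And>i x y. i \<in> {1..N} \<Longrightarrow> dist (f i x) (f i y) = r i * dist x y" by metis
  have "Max (r ` {1..N}) \<in> r ` {1..N}" "Min (r ` {1..N}) \<in> r ` {1..N}"
    using N by (intro Max_in Min_in; simp)+
  then obtain j m where j: "j \<in> {1..N}" "Max (r ` {1..N}) = r j"
    and m: "m \<in> {1..N}" "Min (r ` {1..N}) = r m" by blast
  have jmax: "r i \<le> r j" and mmin: "r m \<le> r i" if "i \<in> {1..N}" for i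
    using that N(2) j(2) m(2) by (metis Max_ge finite_imageI imageI, metis Min_le finite_imageI imageI)
  note j = j(1) and m = m(1)
  have "joint_spectral_radius N f = r j"
    using similarity_linear_part[OF aff r] r0 jmax j
    by (intro joint_spectral_radius_similarities) (auto intro: less_imp_le)
  then have th: "threshold N f = 1 / r j" by (simp add: threshold_def)
  define d where "d = CARD('n)"
  have d: "d > 0" by (simp add: d_def)
  define \<tau> where "\<tau> = root d (1 / (r j ^ d + r m ^ d))"
  have pos: "r j ^ d > 0" "r m ^ d > 0" using r0 j m by auto
  have \<tau>0: "0 \<le> \<tau>" using pos d by (simp add: \<tau>_def)
  have \<tau>d: "\<tau> ^ d = 1 / (r j ^ d + r m ^ d)"
    unfolding \<tau>_def using pos d by (intro real_root_pow_pos2) auto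
  have "\<tau> < 1 / r j"
  proof (rule power_less_imp_less_base)
    show "\<tau> ^ d < (1 / r j) ^ d"
      unfolding \<tau>d power_one_over using pos by (simp add: frac_less2 divide_inverse)
    show "0 \<le> 1 / r j" using r0[OF j] by simp
  qed
  moreover have "\<exists>A. is_attractor (family_at N f q t) A \<and> connected A"
    if t: "\<tau> < t" "t < 1 / r j" for t
    unfolding family_at_def
  proof (rule attractor_connected_of_large_ratios[OF N(2,1) _ _ _ j])
    have t0: "t > 0" using t \<tau>0 by linarith
    fix i assume i: "i \<in> {1..N}"
    show "dist (t *\<^sub>R f i x + q i) (t *\<^sub>R f i y + q i) = t * r i * dist x y" for x y
      using r[OF i, of x y] t0 by (simp add: dist_norm flip: scaleR_diff_right)
    show "0 < t * r i" using t0 r0[OF i] by simp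
    have "t * r i \<le> t * r j" using jmax[OF i] t0 by simp
    also have "\<dots> < 1" using t(2) r0[OF j] by (simp add: pos_less_divide_eq)
    finally show "t * r i < 1" .
    have "\<tau> ^ d < t ^ d" using t(1) \<tau>0 d by (intro power_strict_mono) auto
    then have "1 < t ^ d * (r j ^ d + r m ^ d)"
      unfolding \<tau>d using pos by (simp add: pos_divide_less_eq)
    also have "\<dots> \<le> t ^ d * (r j ^ d + r i ^ d)"
      using t0 mmin[OF i] r0[OF m] by (intro mult_left_mono add_left_mono power_mono) auto
    finally show "1 < (t * r j) ^ CARD('n) + (t * r i) ^ CARD('n)"
      by (simp add: d_def power_mult_distrib distrib_left)
  qed
  ultimately show ?thesis using \<tau>0 th by auto
qed

end
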